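(* The Alexander polynomial $\Delta_Q(t)$ is invariant under cyclic shifts, wiggles, and proper mutations. That is: (a) for a quiver $Q$, the polynomial $\Delta_Q(t)$ computed with respect to a linear ordering of the vertices does not change when this linear ordering is cyclically shifted (so that it is well defined for a cyclically ordered quiver); and (b) if a cyclically ordered quiver $(Q',\sigma')$ is obtained from $(Q,\sigma)$ by a wiggle or by a proper mutation at a proper vertex, then their Alexander polynomials coincide.
   Context: A quiver is a finite directed graph without loops or oriented 2-cycles; multiple arrows are allowed. Mutation $\mu_j$ of a quiver at a vertex $j$: for each path $i\to j\to k$ add an arrow $i\to k$; reverse all arrows incident to $j$; repeatedly remove oriented 2-cycles. A cyclic ordering $\sigma=(v_1,\dots,v_n)$ of the vertex set is a linear ordering $v_1<\dots<v_n$ considered up to cyclic shifts ("clockwise" placement on a circle); the $n$ linear orderings in this class are called compatible with $\sigma$. A cyclically ordered quiver (COQ) $(Q,\sigma)$ is a quiver with a cyclic ordering of its vertices. A wiggle transforms $(Q,\sigma)$ into $(Q,\sigma')$ where $\sigma'$ is obtained from $\sigma$ by interchanging two vertices that are consecutive in $\sigma$ and not adjacent in $Q$. A path $i\to j\to k$ in $Q$ makes a right turn at $j$ if $\sigma=(\dots,i,\dots,j,\dots,k,\dots)$. A vertex $j$ is proper in $(Q,\sigma)$ if every oriented two-arrow path $i\to j\to k$ in $Q$ makes a right turn at $j$. Let $\operatorname{In}(j)$ (resp., $\operatorname{Out}(j)$) be the set of vertices $i$ with an arrow $i\to j$ (resp., $j\to i$) in $Q$. If $j$ is proper, the proper mutation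 $\mu_j(Q,\sigma)$ is the quiver $\mu_j(Q)$ with the cyclic ordering obtained from $\sigma$ by keeping the placement of all vertices other than $j$ and moving $j$ clockwise past all the vertices in $\operatorname{Out}(j)$ (each exactly once) without passing any vertex in $\operatorname{In}(j)$. This placement is well defined up to wiggles of the mutated COQ; for a sink or source $j$ the cyclic ordering does not change (up to wiggles). Given a linear ordering $v_1<\dots<v_n$ of the vertices, the exchange matrix $B=(b_{ij})$ is the skew-symmetric integer matrix with $b_{ij}=x$ if $Q$ contains $x\ge0$ arrows $v_i\to v_j$ and $b_{ij}=-x$ if $Q$ contains $x\ge 0$ arrows $v_j\to v_i$. The unipotent companion $U_Q$ is the unique unipotent upper-triangular matrix $U$ with $-B=U-U^T$. The Alexander polynomial is $\Delta_Q(t)=\det(tU_Q-U_Q^T)\in\mathbb Z[t]$, i.e., the monic characteristic polynomial of $U_Q^{-T}U_Q$, where $U^{-T}=(U^T)^{-1}$. *)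

theory Defs
  imports
    "Jordan_Normal_Form.Determinant"
    "HOL-Computational_Algebra.Polynomial"
    "HOL-Combinatorics.Multiset_Permutations"
begin

(* The arrows are recorded by their multiplicities: num_arrows Q i k is the number of arrows
   i \<rightarrow> k.  It vanishes off the vertex set, so that equality of records is equality of quivers. *)
record 'v quiver =
  verts :: "'v set"
  num_arrows :: "'v \<Rightarrow> 'v \<Rightarrow> nat"

definition arrow :: "'v quiver \<Rightarrow> 'v \<Rightarrow> 'v \<Rightarrow> bool" where
  "arrow Q i k \<longleftrightarrow> num_arrows Q i k > 0"

definition is_quiver :: "'v quiver \<Rightarrow> bool" where
  "is_quiver Q \<longleftrightarrow>
     finite (verts Q) \<and>
     (\<forall>i k. arrow Q i k \<longrightarrow> i \<in> verts Q \<and> k \<in> verts Q) \<and>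
     (\<forall>i. \<not> arrow Q i i) \<and>
     (\<forall>i k. \<not> (arrow Q i k \<and> arrow Q k i))"

definition In_set :: "'v quiver \<Rightarrow> 'v \<Rightarrow> 'v set" where
  "In_set Q j = {i. arrow Q i j}"

definition Out_set :: "'v quiver \<Rightarrow> 'v \<Rightarrow> 'v set" where
  "Out_set Q j = {i. arrow Q j i}"

(* Arrow multiplicities after the first two steps of the mutation at j: there are
   num_arrows Q i j * num_arrows Q j k paths i \<rightarrow> j \<rightarrow> k. *)
definition pre_mutate :: "'v \<Rightarrow> 'v quiver \<Rightarrow> 'v \<Rightarrow> 'v \<Rightarrow> nat" where
  "pre_mutate j Q i k =
     (if i = j \<or> k = j then num_arrows Q k i
      else num_arrows Q i k + num_arrows Q i j * num_arrows Q j k)"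

(* Removing oriented 2-cycles between i and k as long as there are any leaves
   the truncated difference of the two multiplicities. *)
definition mutate :: "'v \<Rightarrow> 'v quiver \<Rightarrow> 'v quiver" where
  "mutate j Q = \<lparr>verts = verts Q,
     num_arrows = (\<lambda>i k. pre_mutate j Q i k - pre_mutate j Q k i)\<rparr>"

lemma is_quiver_mutate:
  assumes "is_quiver Q"
  shows "is_quiver (mutate j Q)"
proof -
  have q: "num_arrows Q i k > 0 \<Longrightarrow> i \<in> verts Q \<and> k \<in> verts Q" for i k
    using assms by (auto simp: is_quiver_def arrow_def)
  have p: "i \<in> verts Q \<and> k \<in> verts Q" if "pre_mutate j Q i k > 0" for i k
    using that q[of k i] q[of i k] q[of i j] q[of j k]
    by (auto simp: pre_mutate_def split: if_splits)
  have "i \<in> verts Q \<and> k \<in> verts Q" if "arrow (mutate j Q) i k" for i k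
    using that p[of i k] by (simp add: arrow_def mutate_def)
  then show ?thesis
    using assms by (auto simp: is_quiver_def arrow_def mutate_def)
qed

(* A linear ordering v_1 < ... < v_n of a finite set V is a list in permutations_of_set V,
   and a cyclic ordering is the set of all linear orderings compatible with it. *)
definition cyclic_class :: "'v list \<Rightarrow> 'v list set" where
  "cyclic_class vs = {rotate m vs | m. True}"

definition cyclic_ordering_on :: "'v set \<Rightarrow> 'v list set \<Rightarrow> bool" where
  "cyclic_ordering_on V \<sigma> \<longleftrightarrow> (\<exists>vs \<in> permutations_of_set V. \<sigma> = cyclic_class vs)"

type_synonym 'v coq = "'v quiver \<times> 'v list set"

definition is_coq :: "'v coq \<Rightarrow> bool" where
  "is_coq C \<longleftrightarrow> is_quiver (fst C) \<and> cyclic_ordering_on (verts (fst C)) (snd C)"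

inductive wiggle :: "'v coq \<Rightarrow> 'v coq \<Rightarrow> bool" where
  "u # v # xs \<in> \<sigma> \<Longrightarrow> \<not> arrow Q u v \<Longrightarrow> \<not> arrow Q v u \<Longrightarrow>
     wiggle (Q, \<sigma>) (Q, cyclic_class (v # u # xs))"

definition right_turn :: "'v list set \<Rightarrow> 'v \<Rightarrow> 'v \<Rightarrow> 'v \<Rightarrow> bool" where
  "right_turn \<sigma> i j k \<longleftrightarrow> (\<exists>as bs cs ds. as @ [i] @ bs @ [j] @ cs @ [k] @ ds \<in> \<sigma>)"

definition proper_vertex :: "'v coq \<Rightarrow> 'v \<Rightarrow> bool" where
  "proper_vertex C j \<longleftrightarrow>
     j \<in> verts (fst C) \<and>
     (\<forall>i k. arrow (fst C) i j \<and> arrow (fst C) j k \<longrightarrow> right_turn (snd C) i j k)"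

(* A relation rather than a function, since the new placement of j is determined only up to
   wiggles of the mutated COQ.  In the linear ordering j # xs @ ys, which starts at j and runs
   clockwise, xs consists of the vertices that j moves past. *)
inductive proper_mutation :: "'v \<Rightarrow> 'v coq \<Rightarrow> 'v coq \<Rightarrow> bool" where
  "proper_vertex (Q, \<sigma>) j \<Longrightarrow> j # xs @ ys \<in> \<sigma> \<Longrightarrow>
     Out_set Q j \<subseteq> set xs \<Longrightarrow> In_set Q j \<inter> set xs = {} \<Longrightarrow>
     proper_mutation j (Q, \<sigma>) (mutate j Q, cyclic_class (xs @ j # ys))"

(* At most one of the two multiplicities is nonzero. *)
definition exchange_matrix :: "'v quiver \<Rightarrow> 'v list \<Rightarrow> int mat" where
  "exchange_matrix Q vs = mat (length vs) (length vs)
     (\<lambda>(i, j). int (num_arrows Q (vs ! i) (vs ! j)) - int (num_arrows Q (vs ! j) (vs ! i)))"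

definition unipotent_upper_triangular :: "nat \<Rightarrow> int mat \<Rightarrow> bool" where
  "unipotent_upper_triangular n U \<longleftrightarrow>
     U \<in> carrier_mat n n \<and> upper_triangular U \<and> (\<forall>i<n. U $$ (i, i) = 1)"

definition is_unipotent_companion :: "'v quiver \<Rightarrow> 'v list \<Rightarrow> int mat \<Rightarrow> bool" where
  "is_unipotent_companion Q vs U \<longleftrightarrow>
     unipotent_upper_triangular (length vs) U \<and> - exchange_matrix Q vs = U - transpose_mat U"

definition unipotent_companion :: "'v quiver \<Rightarrow> 'v list \<Rightarrow> int mat" where
  "unipotent_companion Q vs = (THE U. is_unipotent_companion Q vs U)"

lemma ex1_unipotent_companion: "\<exists>!U. is_unipotent_companion Q vs U"
proof
  let ?n = "length vs" and ?B = "exchange_matrix Q vs"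
  let ?U = "mat ?n ?n (\<lambda>(i, j). if i = j then 1 else if i < j then - ?B $$ (i, j) else 0)"
  show "is_unipotent_companion Q vs ?U"
    unfolding is_unipotent_companion_def unipotent_upper_triangular_def
    by (auto simp: exchange_matrix_def intro!: eq_matI)
  fix U assume U: "is_unipotent_companion Q vs U"
  then have c: "U \<in> carrier_mat ?n ?n" "upper_triangular U" "\<And>i. i < ?n \<Longrightarrow> U $$ (i, i) = 1"
    and e: "- ?B = U - transpose_mat U"
    by (auto simp: is_unipotent_companion_def unipotent_upper_triangular_def)
  have B: "?B \<in> carrier_mat ?n ?n" by (simp add: exchange_matrix_def)
  have "U $$ (i, j) = ?U $$ (i, j)" if ij: "i < ?n" "j < ?n" for i j
  proof -
    have "(- ?B) $$ (i, j) = (U - transpose_mat U) $$ (i, j)" using e by simp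
    then have *: "- (?B $$ (i, j)) = U $$ (i, j) - U $$ (j, i)" using c(1) B ij by simp
    have "U $$ (j, i) = 0" if "i < j" using c(1,2) ij that by auto
    moreover have "U $$ (i, j) = 0" if "j < i" using c(1,2) ij that by auto
    ultimately show ?thesis using * c(3) ij by auto
  qed
  then show "U = ?U" using c(1) by (intro eq_matI) auto
qed

definition alexander_poly :: "'v quiver \<Rightarrow> 'v list \<Rightarrow> int poly" where
  "alexander_poly Q vs =
     (let U = map_mat (\<lambda>a. [:a:]) (unipotent_companion Q vs)
      in det ([:0, 1:] \<cdot>\<^sub>m U - transpose_mat U))"

(* The common value over all linear orderings compatible with the cyclic ordering;
   it is unspecified unless these orderings all give the same polynomial. *)
definition coq_alexander_poly :: "'v coq \<Rightarrow> int poly" where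
  "coq_alexander_poly C = (THE p. \<forall>vs \<in> snd C. alexander_poly (fst C) vs = p)"

end

theory Submission
  imports Defs
begin

text \<open>
  Let \<open>M\<close> be the matrix \<open>t U - U\<^sup>T\<close>: its diagonal entries are \<open>t - 1\<close>, and the entry at \<open>(u, w)\<close> is
  \<open>- b\<^sub>u\<^sub>w\<close>, multiplied by \<open>t\<close> if \<open>u\<close> precedes \<open>w\<close>. Simultaneous permutations of rows and columns
  leave the determinant unchanged, so only the dependence of the entries on the ordering matters.
  A wiggle does not affect the entries. Moving the first vertex \<open>j\<close> to the end divides its row by
  \<open>t\<close> and multiplies its column by \<open>t\<close>. For a proper mutation put \<open>j\<close> first, followed by
  the vertices that \<open>j\<close> moves past. The new matrix is \<open>P\<^sup>T M P\<close>, where \<open>P\<close> adds to the column of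
  every such vertex \<open>x\<close> the column of \<open>j\<close> as many times as there are arrows \<open>j \<rightarrow> x\<close>,
  and negates the column of \<open>j\<close>; hence \<open>det P = -1\<close>.
\<close>

section \<open>Determinants with entries indexed by vertices\<close>

definition list_det :: "('v \<Rightarrow> 'v \<Rightarrow> 'a::comm_ring_1) \<Rightarrow> 'v list \<Rightarrow> 'a" where
  "list_det F vs = det (mat (length vs) (length vs) (\<lambda>(i, j). F (vs ! i) (vs ! j)))"

lemma list_det_cong:
  assumes "\<And>u w. u \<in> set vs \<Longrightarrow> w \<in> set vs \<Longrightarrow> F u w = G u w"
  shows "list_det F vs = list_det G vs"
  unfolding list_det_def using assms by (intro arg_cong[where f = det] eq_matI) auto

lemma list_det_transpose: "list_det (\<lambda>u w. F w u) vs = list_det F vs"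
proof -
  let ?A = "mat (length vs) (length vs) (\<lambda>(i, j). F (vs ! i) (vs ! j))"
  have "mat (length vs) (length vs) (\<lambda>(i, j). F (vs ! j) (vs ! i)) = transpose_mat ?A"
    by (intro eq_matI) auto
  then show ?thesis
    unfolding list_det_def by (simp add: det_transpose[of _ "length vs"])
qed

text \<open>Rows and columns are permuted by the same \<open>p\<close>, so \<open>signof p\<close>
  occurs twice and cancels. Since \<open>F\<close> takes vertices, not positions, it is the same
  function on both sides.\<close>

lemma list_det_perm:
  assumes "mset us = mset vs"
  shows "list_det F us = list_det F vs"
proof -
  let ?n = "length vs"
  obtain p where p: "p permutes {..<?n}" and us: "permute_list p vs = us"
    using mset_eq_permutation[OF assms] by blast
  have p': "p permutes {0..<?n}" using p by (simp add: atLeast0LessThan)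
  have lt: "p i < ?n" if "i < ?n" for i
    using permutes_in_image[OF p, of i] that by simp
  let ?A = "mat ?n ?n (\<lambda>(i, j). F (vs ! i) (vs ! j))"
  let ?B = "mat ?n ?n (\<lambda>(i, j). ?A $$ (p i, j))"
  let ?C = "mat ?n ?n (\<lambda>(i, j). transpose_mat ?B $$ (p i, j))"
  have B: "det ?B = signof p * det ?A"
    by (rule det_permute_rows[OF _ p']) simp
  have "det ?C = signof p * det (transpose_mat ?B)"
    by (rule det_permute_rows[OF _ p']) simp
  also have "\<dots> = signof p * (signof p * det ?A)"
    using B by (simp add: det_transpose[of _ ?n])
  also have "\<dots> = det ?A"
    by (simp add: sign_def)
  finally have C: "det ?C = det ?A" .
  have "mat (length us) (length us) (\<lambda>(i, j). F (us ! i) (us ! j)) = transpose_mat ?C"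
    using us lt p by (intro eq_matI) (auto simp: permute_list_nth)
  then show ?thesis
    unfolding list_det_def using C by (simp add: det_transpose[of _ ?n])
qed

text \<open>The operation is right multiplication by the identity plus a first row \<open>q\<close>,
  an upper triangular matrix with diagonal \<open>1 + q j, 1, ..., 1\<close>. The case
  \<open>w = j\<close> is included: it scales the column of \<open>j\<close> by
  \<open>1 + q j\<close>.\<close>

lemma list_det_add_first_col:
  assumes "distinct (j # zs)"
  shows "list_det (\<lambda>u w. F u w + q w * F u j) (j # zs) = (1 + q j) * list_det F (j # zs)"
proof -
  let ?vs = "j # zs" let ?n = "length ?vs"
  let ?M = "mat ?n ?n (\<lambda>(i, k). F (?vs ! i) (?vs ! k))"
  let ?P = "mat ?n ?n (\<lambda>(i, k). (if i = k then 1 else 0) + (if i = 0 then q (?vs ! k) else 0))"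
  have "mat ?n ?n (\<lambda>(i, k). F (?vs ! i) (?vs ! k) + q (?vs ! k) * F (?vs ! i) j) = ?M * ?P"
  proof (rule eq_matI)
    fix i k assume "i < dim_row (?M * ?P)" "k < dim_col (?M * ?P)"
    then have ik: "i < ?n" "k < ?n" by auto
    have "(?M * ?P) $$ (i, k) = (\<Sum>l = 0..<?n. F (?vs ! i) (?vs ! l) *
        ((if l = k then 1 else 0) + (if l = 0 then q (?vs ! k) else 0)))"
      using ik by (simp add: scalar_prod_def)
    also have "\<dots> = (\<Sum>l = 0..<?n. (if l = k then F (?vs ! i) (?vs ! l) else 0) +
        (if l = 0 then F (?vs ! i) (?vs ! l) * q (?vs ! k) else 0))"
      by (intro sum.cong) (auto simp: distrib_left)
    also have "\<dots> = F (?vs ! i) (?vs ! k) + F (?vs ! i) j * q (?vs ! k)"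
      using ik by (simp only: sum.distrib sum.delta finite_atLeastLessThan) auto
    finally show "mat ?n ?n (\<lambda>(i, k). F (?vs ! i) (?vs ! k) + q (?vs ! k) * F (?vs ! i) j) $$ (i, k)
        = (?M * ?P) $$ (i, k)"
      using ik by (simp add: mult.commute)
  qed auto
  then have "list_det (\<lambda>u w. F u w + q w * F u j) ?vs = det ?M * det ?P"
    unfolding list_det_def by (simp only: det_mult[of _ ?n] mat_carrier)
  moreover have "det ?P = 1 + q j"
  proof -
    have "det ?P = (\<Prod>i = 0..<?n. ?P $$ (i, i))"
      by (subst det_upper_triangular[of _ ?n]) (auto simp: prod_list_diag_prod)
    also have "\<dots> = (\<Prod>i = 0..<?n. if i = 0 then 1 + q j else 1)"
      by (intro prod.cong) auto
    also have "\<dots> = 1 + q j"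
      by (simp only: prod.delta finite_atLeastLessThan) simp
    finally show ?thesis .
  qed
  ultimately show ?thesis
    by (simp add: list_det_def mult.commute)
qed

lemma list_det_add_first_row:
  assumes "distinct (j # zs)"
  shows "list_det (\<lambda>u w. F u w + p u * F j w) (j # zs) = (1 + p j) * list_det F (j # zs)"
  using list_det_add_first_col[OF assms, of "\<lambda>u w. F w u" p]
    list_det_transpose[of "\<lambda>u w. F u w + p u * F j w" "j # zs"] list_det_transpose[of F "j # zs"]
  by simp

section \<open>The entries of the matrix in terms of precedence\<close>

fun before :: "'v list \<Rightarrow> 'v \<Rightarrow> 'v \<Rightarrow> bool" where
  "before [] u w \<longleftrightarrow> False"
| "before (x # xs) u w \<longleftrightarrow> u = x \<and> w \<in> set xs \<or> before xs u w"

lemma before_append: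
  "before (xs @ ys) u w \<longleftrightarrow> before xs u w \<or> before ys u w \<or> u \<in> set xs \<and> w \<in> set ys"
  by (induction xs) auto

lemma before_in_set: "before xs u w \<Longrightarrow> u \<in> set xs \<and> w \<in> set xs"
  by (induction xs) auto

lemma not_before: "u \<notin> set xs \<or> w \<notin> set xs \<Longrightarrow> \<not> before xs u w"
  using before_in_set by metis

lemma before_nth:
  assumes "distinct vs" "i < length vs" "k < length vs"
  shows "before vs (vs ! i) (vs ! k) \<longleftrightarrow> i < k"
  using assms
proof (induction vs arbitrary: i k)
  case (Cons x xs)
  then show ?case
    by (cases i; cases k) (auto dest: before_in_set)
qed simp

definition net_arrows :: "'v quiver \<Rightarrow> 'v \<Rightarrow> 'v \<Rightarrow> int" where
  "net_arrows Q u w = int (num_arrows Q u w) - int (num_arrows Q w u)"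

text \<open>By skew-symmetry both triangles get the same sign: if \<open>w\<close> precedes
  \<open>u\<close>, the entry is minus that of \<open>U\<close> at \<open>(w, u)\<close>, which is
  \<open>net_arrows Q w u = - net_arrows Q u w\<close>.\<close>

definition alexander_entry :: "'v quiver \<Rightarrow> 'v list \<Rightarrow> 'v \<Rightarrow> 'v \<Rightarrow> int poly" where
  "alexander_entry Q vs u w =
     (if u = w then [:0, 1:] - 1
      else - of_int (net_arrows Q u w) * (if before vs u w then [:0, 1:] else 1))"

lemma unipotent_companion_eq:
  "unipotent_companion Q vs = mat (length vs) (length vs)
     (\<lambda>(i, k). if i = k then 1 else if i < k then - net_arrows Q (vs ! i) (vs ! k) else 0)"
    (is "_ = ?U")
proof -
  have "is_unipotent_companion Q vs ?U"
    unfolding is_unipotent_companion_def unipotent_upper_triangular_def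
    by (auto simp: exchange_matrix_def net_arrows_def intro!: eq_matI)
  then show ?thesis
    unfolding unipotent_companion_def by (intro the1_equality ex1_unipotent_companion)
qed

lemma alexander_poly_eq_list_det:
  assumes "distinct vs"
  shows "alexander_poly Q vs = list_det (alexander_entry Q vs) vs"
  unfolding alexander_poly_def list_det_def Let_def unipotent_companion_eq
  using assms
  by (intro arg_cong[where f = det] eq_matI)
     (auto simp: alexander_entry_def before_nth nth_eq_iff_index_eq of_int_poly net_arrows_def
        one_pCons)

section \<open>Cyclic shifts and wiggles\<close>

lemma alexander_poly_rotate1:
  assumes "distinct vs"
  shows "alexander_poly Q (rotate1 vs) = alexander_poly Q vs"
proof (cases vs)
  case (Cons j zs)
  let ?t = "[:0, 1:] :: int poly" and ?q = "\<lambda>u. if u = j then [:0, 1:] - 1 else (0 :: int poly)"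
  let ?E = "alexander_entry Q (j # zs)" and ?E' = "alexander_entry Q (zs @ [j])"
  have d: "distinct (j # zs)" using assms Cons by simp
  \<comment> \<open>With \<open>?q\<close>, the row and column operations just scale by
    \<open>t\<close>. To avoid division, the row of \<open>j\<close> is scaled in the new matrix and
    its column in the old one; the results agree and \<open>t\<close> cancels.\<close>
  have "?t * list_det ?E' (j # zs) = list_det (\<lambda>u w. ?E' u w + ?q u * ?E' j w) (j # zs)"
    using list_det_add_first_row[OF d, of ?E' ?q] by simp
  also have "\<dots> = list_det (\<lambda>u w. ?E u w + ?q w * ?E u j) (j # zs)"
    using d by (intro list_det_cong)
      (auto simp: alexander_entry_def before_append algebra_simps dest: before_in_set)
  also have "\<dots> = ?t * list_det ?E (j # zs)"
    using list_det_add_first_col[OF d, of ?E ?q] by simp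
  finally have "list_det ?E' (j # zs) = list_det ?E (j # zs)"
    by (subst (asm) mult_left_cancel) simp_all
  moreover have "list_det ?E' (zs @ [j]) = list_det ?E' (j # zs)"
    by (rule list_det_perm) simp
  ultimately show ?thesis
    using d Cons by (simp add: alexander_poly_eq_list_det)
qed simp

lemma alexander_poly_rotate:
  assumes "distinct vs"
  shows "alexander_poly Q (rotate m vs) = alexander_poly Q vs"
  using assms by (induction m) (simp_all add: alexander_poly_rotate1)

lemma alexander_poly_wiggle:
  assumes "distinct (u # v # xs)" "\<not> arrow Q u v" "\<not> arrow Q v u"
  shows "alexander_poly Q (v # u # xs) = alexander_poly Q (u # v # xs)"
proof -
  have "list_det (alexander_entry Q (v # u # xs)) (v # u # xs) =
      list_det (alexander_entry Q (v # u # xs)) (u # v # xs)"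
    by (rule list_det_perm) simp
  \<comment> \<open>Precedence changes only between \<open>u\<close> and \<open>v\<close>, where
    \<open>net_arrows\<close> vanishes.\<close>
  also have "\<dots> = list_det (alexander_entry Q (u # v # xs)) (u # v # xs)"
    using assms
    by (intro list_det_cong) (auto simp: alexander_entry_def arrow_def net_arrows_def)
  finally show ?thesis
    using assms by (auto simp: alexander_poly_eq_list_det)
qed

section \<open>Proper mutations\<close>

lemma net_arrows_mutate:
  "net_arrows (mutate j Q) u w =
     (if u = j \<or> w = j then - net_arrows Q u w
      else net_arrows Q u w + int (num_arrows Q u j * num_arrows Q j w)
             - int (num_arrows Q w j * num_arrows Q j u))"
proof -
  \<comment> \<open>Removing 2-cycles does not change the difference of the two
    multiplicities.\<close>
  have "net_arrows (mutate j Q) u w = int (pre_mutate j Q u w) - int (pre_mutate j Q w u)"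
    by (simp add: net_arrows_def mutate_def)
  then show ?thesis
    by (auto simp: pre_mutate_def net_arrows_def)
qed

lemma alexander_poly_mutate:
  fixes Q :: "'v quiver"
  assumes d: "distinct (j # xs @ ys)"
    and out: "Out_set Q j \<subseteq> set xs" and inn: "In_set Q j \<inter> set xs = {}"
  shows "alexander_poly (mutate j Q) (xs @ j # ys) = alexander_poly Q (j # xs @ ys)"
proof -
  let ?E = "alexander_entry Q (j # xs @ ys)"
  let ?E' = "alexander_entry (mutate j Q) (xs @ j # ys)"
  \<comment> \<open>The value \<open>-2\<close> turns the column operation at \<open>j\<close> itself into a change of sign.\<close>
  let ?p = "\<lambda>u. if u = j then -2 else (of_nat (num_arrows Q j u) :: int poly)"
  let ?G = "\<lambda>u w. ?E u w + ?p w * ?E u j"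
  have no_in: "num_arrows Q u j = 0" if "u \<in> set xs" for u
    using inn that by (auto simp: In_set_def arrow_def)
  have no_out: "num_arrows Q j u = 0" if "u \<in> set ys" for u
    using out d that by (auto simp: Out_set_def arrow_def)
  have net_xs: "net_arrows Q j u = int (num_arrows Q j u)"
      "net_arrows Q u j = - int (num_arrows Q j u)" if "u \<in> set xs" for u
    using no_in[OF that] by (simp_all add: net_arrows_def)
  have net_ys: "net_arrows Q j u = - int (num_arrows Q u j)"
      "net_arrows Q u j = int (num_arrows Q u j)" if "u \<in> set ys" for u
    using no_out[OF that] by (simp_all add: net_arrows_def)
  \<comment> \<open>An opaque name for \<open>t\<close> makes the simplifier treat it as an
    atom.\<close>
  obtain X where "X = [:0, 1 :: int:]" by simp
  then have entry: "alexander_entry R vs u w = (if u = w then X - 1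
      else - of_int (net_arrows R u w) * (if before vs u w then X else 1))" for R vs and u w :: 'v
    by (simp add: alexander_entry_def)
  \<comment> \<open>For \<open>u\<close>, \<open>w\<close> in \<open>xs\<close> the corrections
    \<open>?p u * ?p w\<close>, \<open>- X * ?p u * ?p w\<close> and
    \<open>(X - 1) * ?p u * ?p w\<close> cancel. Between \<open>xs\<close> and \<open>ys\<close> a
    single correction survives and counts the paths through \<open>j\<close>; inside
    \<open>ys\<close> there is none.\<close>
  have eq: "?E' u w = ?G u w + ?p u * ?G j w"
    if uw: "u \<in> set (j # xs @ ys)" "w \<in> set (j # xs @ ys)" for u w
  proof -
    have "v = j \<or> v \<in> set xs \<and> v \<noteq> j \<and> v \<notin> set ys \<or> v \<in> set ys \<and> v \<noteq> j \<and> v \<notin> set xs"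
      if "v \<in> set (j # xs @ ys)" for v
      using that d by auto
    from this[OF uw(1)] this[OF uw(2)] show ?thesis
      using d
      by (elim disjE conjE; cases "u = w")
        (simp_all add: entry net_arrows_mutate before_append not_before no_in no_out
           net_xs net_ys algebra_simps)
  qed
  have "list_det ?E' (xs @ j # ys) = list_det ?E' (j # xs @ ys)"
    by (rule list_det_perm) simp
  also have "\<dots> = list_det (\<lambda>u w. ?G u w + ?p u * ?G j w) (j # xs @ ys)"
    using eq by (rule list_det_cong)
  also have "\<dots> = (1 + ?p j) * list_det ?G (j # xs @ ys)"
    by (rule list_det_add_first_row[OF d, of ?G ?p])
  also have "list_det ?G (j # xs @ ys) = (1 + ?p j) * list_det ?E (j # xs @ ys)"
    by (rule list_det_add_first_col[OF d, of ?E ?p])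
  \<comment> \<open>Both factors \<open>1 + ?p j\<close> are \<open>-1\<close>.\<close>
  also have "(1 + ?p j) * \<dots> = list_det ?E (j # xs @ ys)"
    by simp
  finally show ?thesis
    using d by (simp add: alexander_poly_eq_list_det)
qed

section \<open>Passage to cyclic orderings\<close>

lemma coq_alexander_poly_cyclic_class:
  assumes "distinct vs"
  shows "coq_alexander_poly (Q, cyclic_class vs) = alexander_poly Q vs"
proof -
  \<comment> \<open>A nonempty class is what makes the value in the definite description
    unique.\<close>
  have "rotate 0 vs \<in> cyclic_class vs"
    unfolding cyclic_class_def by blast
  then show ?thesis
    unfolding coq_alexander_poly_def
    by (intro the_equality) (auto simp: cyclic_class_def alexander_poly_rotate[OF assms])
qed

lemma coq_alexander_poly_eq:
  assumes "is_coq (Q, \<sigma>)" "vs \<in> \<sigma>"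
  shows "distinct vs" "coq_alexander_poly (Q, \<sigma>) = alexander_poly Q vs"
proof -
  obtain ws m where "distinct ws" "\<sigma> = cyclic_class ws" "vs = rotate m ws"
    using assms
    by (auto simp: is_coq_def cyclic_ordering_on_def permutations_of_set_def cyclic_class_def)
  then show "distinct vs" "coq_alexander_poly (Q, \<sigma>) = alexander_poly Q vs"
    by (simp_all add: coq_alexander_poly_cyclic_class alexander_poly_rotate)
qed

lemma coq_alexander_poly_wiggle:
  assumes "is_coq (Q, \<sigma>)" "wiggle (Q, \<sigma>) (Q', \<sigma>')"
  shows "coq_alexander_poly (Q', \<sigma>') = coq_alexander_poly (Q, \<sigma>)"
  using assms(2)
proof cases
  case (1 u v xs)
  note eqs = coq_alexander_poly_eq[OF assms(1) 1(3)]
  have "coq_alexander_poly (Q, cyclic_class (v # u # xs)) = alexander_poly Q (v # u # xs)"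
    using eqs(1) by (intro coq_alexander_poly_cyclic_class) auto
  then show ?thesis
    using alexander_poly_wiggle[OF eqs(1) 1(4,5)] eqs(2) 1(1,2) by simp
qed

lemma coq_alexander_poly_proper_mutation:
  assumes "is_coq (Q, \<sigma>)" "proper_mutation j (Q, \<sigma>) (Q', \<sigma>')"
  shows "coq_alexander_poly (Q', \<sigma>') = coq_alexander_poly (Q, \<sigma>)"
  using assms(2)
proof cases
  case (1 xs ys)
  note eqs = coq_alexander_poly_eq[OF assms(1) 1(4)]
  have "coq_alexander_poly (mutate j Q, cyclic_class (xs @ j # ys)) =
      alexander_poly (mutate j Q) (xs @ j # ys)"
    using eqs(1) by (intro coq_alexander_poly_cyclic_class) auto
  then show ?thesis
    using alexander_poly_mutate[OF eqs(1) 1(5,6)] eqs(2) 1(1,2) by simp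
qed

theorem corollary8p5:
  fixes Q :: "'v quiver"
  assumes "is_quiver Q"
  shows "(\<forall>vs \<in> permutations_of_set (verts Q). \<forall>m.
            alexander_poly Q (rotate m vs) = alexander_poly Q vs)
       \<and> (\<forall>\<sigma>. is_coq (Q, \<sigma>) \<longrightarrow>
            (\<forall>vs \<in> \<sigma>. coq_alexander_poly (Q, \<sigma>) = alexander_poly Q vs))
       \<and> (\<forall>\<sigma> Q' \<sigma>'. is_coq (Q, \<sigma>) \<and>
            (wiggle (Q, \<sigma>) (Q', \<sigma>') \<or> (\<exists>j. proper_mutation j (Q, \<sigma>) (Q', \<sigma>'))) \<longrightarrow>
            coq_alexander_poly (Q', \<sigma>') = coq_alexander_poly (Q, \<sigma>))"
  using alexander_poly_rotate coq_alexander_poly_eq(2) coq_alexander_poly_wiggle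
    coq_alexander_poly_proper_mutation
  by (auto simp: permutations_of_set_def)

end
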